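(* Suppose $(\Omega_n,z_n)\in\mathbb{X}_{d,0}$, $A_n\in\mathrm{Aff}(\mathbb{C}^d)$, and $B_n\in\mathrm{Aff}(\mathbb{C}^d)$ ($n\in\mathbb{N}$) are such that $$\lim_{n\to\infty}A_n(\Omega_n,z_n)=(U_1,u_1)\quad\text{and}\quad\lim_{n\to\infty}B_n(\Omega_n,z_n)=(U_2,u_2)$$ in $\mathbb{X}_{d,0}$. Then there exist $n_j\to\infty$ such that $B_{n_j}A_{n_j}^{-1}$ converges to some $T\in\mathrm{Aff}(\mathbb{C}^d)$ and $T(U_1,u_1)=(U_2,u_2)$.
   Context: A convex domain in $\mathbb{C}^d$ is $\mathbb{C}$-properly convex if it contains no entire complex affine line. $\mathbb{X}_d$ is the set of all non-empty $\mathbb{C}$-properly convex domains in $\mathbb{C}^d$, with the local Hausdorff topology: $\Omega_n\to\Omega$ in $\mathbb{X}_d$ if there is $R_0\ge0$ such that for all $R\ge R_0$ the Hausdorff distance between $\overline{\Omega}_n\cap\overline{B(0;R)}$ and $\overline{\Omega}\cap\overline{B(0;R)}$ tends to $0$, where $B(0;R)$ is the Euclidean ball (the Hausdorff distance between the empty set and a non-empty set is $\infty$). $\mathbb{X}_{d,0}$ is the set of pairs $(\Omega,z)$ with $\Omega\in\mathbb{X}_d$ and $z\in\Omega$; $(\Omega_n,z_n)\to(\Omega,z)$ in $\mathbb{X}_{d,0}$ means $\Omega_n\to\Omega$ in $\mathbb{X}_d$ and $z_n\to z$ in $\mathbb{C}^d$. $\mathrm{Aff}(\mathbb{C}^d)$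 is the group of complex affine automorphisms of $\mathbb{C}^d$ with its usual topology, and $A(\Omega,z)=(A\Omega,Az)$. *)

theory Defs
  imports "HOL-Analysis.Analysis"
begin

definition properly_convex :: "(complex ^ 'd) set \<Rightarrow> bool" where
  "properly_convex \<Omega> \<longleftrightarrow>
     convex \<Omega> \<and> \<not> (\<exists>a v. v \<noteq> 0 \<and> range (\<lambda>\<zeta>::complex. a + \<zeta> *s v) \<subseteq> \<Omega>)"

definition XX :: "(complex ^ 'd) set set" where
  "XX = {\<Omega>. open \<Omega> \<and> connected \<Omega> \<and> \<Omega> \<noteq> {} \<and> properly_convex \<Omega>}"

definition XX0 :: "((complex ^ 'd) set \<times> (complex ^ 'd)) set" where
  "XX0 = {(\<Omega>, z). \<Omega> \<in> XX \<and> z \<in> \<Omega>}"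

text \<open>In \<^typ>\<open>ennreal\<close> an empty infimum is \<open>\<infinity>\<close> and an empty supremum is \<open>0\<close>, so the distance
  between the empty set and a non-empty set is \<open>\<infinity>\<close>.\<close>
definition hausdorff_distance :: "'a::metric_space set \<Rightarrow> 'a set \<Rightarrow> ennreal" where
  "hausdorff_distance S T =
     max (SUP x\<in>S. INF y\<in>T. ennreal (dist x y)) (SUP y\<in>T. INF x\<in>S. ennreal (dist x y))"

definition XX_tendsto :: "(nat \<Rightarrow> (complex ^ 'd) set) \<Rightarrow> (complex ^ 'd) set \<Rightarrow> bool" where
  "XX_tendsto \<Omega>s \<Omega> \<longleftrightarrow>
     (\<exists>R0\<ge>0. \<forall>R\<ge>R0.
        (\<lambda>n. hausdorff_distance (closure (\<Omega>s n) \<inter> cball 0 R) (closure \<Omega> \<inter> cball 0 R))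
          \<longlonglongrightarrow> 0)"

definition XX0_tendsto ::
  "(nat \<Rightarrow> (complex ^ 'd) set \<times> (complex ^ 'd)) \<Rightarrow> (complex ^ 'd) set \<times> (complex ^ 'd) \<Rightarrow> bool"
  where
  "XX0_tendsto P p \<longleftrightarrow>
     XX_tendsto (\<lambda>n. fst (P n)) (fst p) \<and> (\<lambda>n. snd (P n)) \<longlonglongrightarrow> snd p"

definition Aff :: "((complex ^ 'd) \<Rightarrow> (complex ^ 'd)) set" where
  "Aff = {f. \<exists>M b. invertible M \<and> f = (\<lambda>z. M *v z + b)}"

definition aff_linear_part :: "((complex ^ 'd) \<Rightarrow> (complex ^ 'd)) \<Rightarrow> complex ^ 'd ^ 'd" where
  "aff_linear_part f = matrix (\<lambda>z. f z - f 0)"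

text \<open>The usual topology on \<^const>\<open>Aff\<close> is that of matrix-translation pairs \<open>(M, b)\<close>; the pair
  belonging to \<open>f\<close> is \<open>(aff_linear_part f, f 0)\<close>.\<close>
lemma aff_linear_part_eq: "aff_linear_part (\<lambda>z. M *v z + b) = M"
  by (simp add: aff_linear_part_def matrix_of_matrix_vector_mul)

definition Aff_tendsto ::
  "(nat \<Rightarrow> (complex ^ 'd) \<Rightarrow> (complex ^ 'd)) \<Rightarrow> ((complex ^ 'd) \<Rightarrow> (complex ^ 'd)) \<Rightarrow> bool" where
  "Aff_tendsto F T \<longleftrightarrow>
     (\<lambda>n. aff_linear_part (F n)) \<longlonglongrightarrow> aff_linear_part T \<and> (\<lambda>n. F n 0) \<longlonglongrightarrow> T 0"

definition aff_act ::
  "((complex ^ 'd) \<Rightarrow> (complex ^ 'd)) \<Rightarrow> (complex ^ 'd) set \<times> (complex ^ 'd)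
     \<Rightarrow> (complex ^ 'd) set \<times> (complex ^ 'd)" where
  "aff_act A p = (A ` fst p, A (snd p))"

end

theory Submission
  imports Defs
begin

text \<open>Write \<open>F\<^sub>n = B\<^sub>n \<circ> A\<^sub>n\<^sup>-\<^sup>1\<close>, which maps \<open>A\<^sub>n \<Omega>\<^sub>n\<close> onto \<open>B\<^sub>n \<Omega>\<^sub>n\<close>. A fixed ball around \<open>u1\<close> lies in
  almost all \<open>A\<^sub>n \<Omega>\<^sub>n\<close>. Were the linear parts of the \<open>F\<^sub>n\<close> unbounded, the images of that ball would
  contain ever larger complex discs around \<open>B\<^sub>n z\<^sub>n\<close>, and a limit of their directions would span a
  complex line through \<open>u2\<close> in the closure of \<open>U2\<close>, hence in \<open>U2\<close> itself. By symmetry the linear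
  parts of the \<open>F\<^sub>n\<^sup>-\<^sup>1\<close> are bounded too, so a subsequence of the \<open>F\<^sub>n\<close> converges to an invertible
  \<open>T\<close>; passing to the limit in \<open>F\<^sub>n (A\<^sub>n \<Omega>\<^sub>n) \<subseteq> B\<^sub>n \<Omega>\<^sub>n\<close> and in its inverse gives \<open>T U1 = U2\<close>.\<close>

section \<open>Complex matrices and affine maps\<close>

lemma norm_vector_scalar_mult:
  fixes v :: "'a::real_normed_div_algebra ^ 'n"
  shows "norm (c *s v) = norm c * norm v"
  by (simp add: norm_vec_def norm_mult L2_set_right_distrib)

lemma norm_axis:
  fixes a :: "'a::real_normed_vector"
  shows "norm (axis i a) = norm a"
  by (simp add: norm_vec_def L2_set_def axis_def if_distrib[of norm]
      if_distrib[of "\<lambda>x. x\<^sup>2"] cong: if_cong)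

lemma tendsto_matrix_vector_mult:
  fixes M :: "'b \<Rightarrow> 'a::real_normed_algebra_1 ^ 'n ^ 'm"
  assumes "(M \<longlongrightarrow> L) F" "(x \<longlongrightarrow> a) F"
  shows "((\<lambda>t. M t *v x t) \<longlongrightarrow> L *v a) F"
  unfolding matrix_vector_mult_def
  by (intro vec_tendstoI) (auto intro!: tendsto_intros assms)

lemma tendsto_matrix_matrix_mult:
  fixes M :: "'b \<Rightarrow> 'a::real_normed_algebra_1 ^ 'n ^ 'm"
  assumes "(M \<longlongrightarrow> L) F" "(N \<longlongrightarrow> K) F"
  shows "((\<lambda>t. M t ** N t) \<longlongrightarrow> L ** K) F"
  unfolding matrix_matrix_mult_def
  by (intro vec_tendstoI) (auto intro!: tendsto_intros assms)

text \<open>Entries of \<open>M\<close> are coordinates of images of unit axis vectors, hence at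
  most \<open>K\<close>; summing them gives a crude bound. It turns an operator bound into one for
  the norm in which subsequences of matrices are extracted.\<close>

lemma norm_matrix_le:
  fixes M :: "'a::real_normed_algebra_1 ^ 'n ^ 'm"
  assumes "\<And>v. norm (M *v v) \<le> K * norm v"
  shows "norm M \<le> of_nat CARD('m) * (of_nat CARD('n) * K)"
proof -
  have entry: "norm (M $ i $ j) \<le> K" for i j
  proof -
    have "M $ i $ j = (M *v axis j 1) $ i"
      by (simp add: axis_def matrix_vector_mult_def if_distrib cong: if_cong)
    also have "norm \<dots> \<le> norm (M *v axis j 1)"
      by (rule Finite_Cartesian_Product.norm_nth_le)
    also have "\<dots> \<le> K"
      using assms[of "axis j 1"] norm_axis[of j "1::'a"] by simp
    finally show ?thesis .
  qed
  have row: "norm (M $ i) \<le> of_nat CARD('n) * K" for i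
  proof -
    have "norm (M $ i) \<le> (\<Sum>j\<in>UNIV. norm (M $ i $ j))"
      unfolding norm_vec_def by (rule L2_set_le_sum) simp
    also have "\<dots> \<le> of_nat CARD('n) * K"
      by (rule sum_bounded_above) (rule entry)
    finally show ?thesis .
  qed
  have "norm M \<le> (\<Sum>i\<in>UNIV. norm (M $ i))"
    unfolding norm_vec_def[of M] by (rule L2_set_le_sum) simp
  also have "\<dots> \<le> of_nat CARD('m) * (of_nat CARD('n) * K)"
    by (rule sum_bounded_above) (rule row)
  finally show ?thesis .
qed

lemma bounded_range_matrices:
  fixes M :: "'b \<Rightarrow> 'a::real_normed_algebra_1 ^ 'n ^ 'm"
  assumes "\<And>t v. norm (M t *v v) \<le> K * norm v"
  shows "bounded (range M)"
  unfolding bounded_iff using norm_matrix_le[OF assms] by blast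

text \<open>The instance \<open>z = 0\<close> says that the total translation
  \<open>M *v d + c\<close> vanishes, which leaves only the linear parts.\<close>

lemma affine_inverse_matrix:
  fixes M N :: "'a::comm_ring_1 ^ 'n ^ 'n"
  assumes "\<And>z. M *v (N *v z + d) + c = z"
  shows "M ** N = mat 1"
proof -
  have "(M ** N) *v z = mat 1 *v z" for z
    using assms[of 0] assms[of z]
    by (simp add: matrix_vector_right_distrib matrix_vector_mul_assoc add.assoc)
  then show ?thesis
    by (simp add: matrix_eq)
qed

lemma Aff_inverse:
  fixes A :: "complex ^ 'd \<Rightarrow> complex ^ 'd"
  assumes "A \<in> Aff"
  shows "bij A" and "\<exists>N d. inv A = (\<lambda>z. N *v z + d)"
proof -
  obtain M b where M: "invertible M" and A: "A = (\<lambda>z. M *v z + b)"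
    using assms by (auto simp: Aff_def)
  obtain N where N: "M ** N = mat 1" "N ** M = mat 1"
    using M by (auto simp: invertible_def)
  define G where "G z = N *v z - N *v b" for z
  have GA: "G (A z) = z" and AG: "A (G z) = z" for z
    by (simp_all add: G_def A matrix_vector_right_distrib matrix_vector_mult_diff_distrib
        matrix_vector_mul_assoc N)
  show "bij A"
    by (rule o_bij[of G]) (auto simp: GA AG)
  have "inv A = (\<lambda>z. N *v z + (- (N *v b)))"
    using inv_equality[of G A, OF GA AG] by (simp add: G_def fun_eq_iff)
  then show "\<exists>N d. inv A = (\<lambda>z. N *v z + d)"
    by blast
qed

lemma Aff_transition:
  fixes A B :: "complex ^ 'd \<Rightarrow> complex ^ 'd"
  assumes "A \<in> Aff" "B \<in> Aff"
  shows "\<exists>M c. B \<circ> inv A = (\<lambda>z. M *v z + c)"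
proof -
  obtain M b where B: "B = (\<lambda>z. M *v z + b)"
    using assms(2) by (auto simp: Aff_def)
  obtain N d where "inv A = (\<lambda>z. N *v z + d)"
    using Aff_inverse(2)[OF assms(1)] by blast
  then have "B \<circ> inv A = (\<lambda>z. (M ** N) *v z + (M *v d + b))"
    by (auto simp: B matrix_vector_right_distrib matrix_vector_mul_assoc)
  then show ?thesis
    by blast
qed

lemma convex_Aff_image:
  fixes S :: "(complex ^ 'd) set"
  assumes "A \<in> Aff" "convex S"
  shows "convex (A ` S)"
proof -
  obtain M b where A: "A = (\<lambda>z. M *v z + b)"
    using assms(1) by (auto simp: Aff_def)
  have "A ` S = (+) b ` ((*v) M ` S)"
    by (auto simp: A image_image add.commute)
  then show ?thesis
    using assms(2) by (simp add: convex_translation convex_linear_image)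
qed

section \<open>Local Hausdorff convergence\<close>

lemma hausdorff_distance_lessD:
  assumes "hausdorff_distance S T < ennreal e"
  shows "x \<in> S \<Longrightarrow> \<exists>y\<in>T. dist x y < e"
    and "y \<in> T \<Longrightarrow> \<exists>x\<in>S. dist x y < e"
proof -
  have S: "(SUP x\<in>S. INF y\<in>T. ennreal (dist x y)) < ennreal e"
    and T: "(SUP y\<in>T. INF x\<in>S. ennreal (dist x y)) < ennreal e"
    using assms by (auto simp: hausdorff_distance_def)
  show "\<exists>y\<in>T. dist x y < e" if "x \<in> S"
    using le_less_trans[OF SUP_upper[OF that] S]
    by (auto simp: INF_less_iff ennreal_less_iff)
  show "\<exists>x\<in>S. dist x y < e" if "y \<in> T"
    using le_less_trans[OF SUP_upper[OF that] T]
    by (auto simp: INF_less_iff ennreal_less_iff)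
qed

lemma XX_tendstoD:
  assumes "XX_tendsto D E"
  obtains R0 where "\<And>R e. R \<ge> R0 \<Longrightarrow> e > 0 \<Longrightarrow>
    \<forall>\<^sub>F n in sequentially.
      hausdorff_distance (closure (D n) \<inter> cball 0 R) (closure E \<inter> cball 0 R) < ennreal e"
proof -
  obtain R0 where R0: "\<And>R. R \<ge> R0 \<Longrightarrow>
      (\<lambda>n. hausdorff_distance (closure (D n) \<inter> cball 0 R) (closure E \<inter> cball 0 R))
        \<longlonglongrightarrow> 0"
    using assms by (auto simp: XX_tendsto_def)
  show thesis
    by (rule that[of R0]) (rule order_tendstoD(2)[OF R0], auto)
qed

lemma XX_tendsto_compose:
  assumes "XX_tendsto D E" "filterlim r at_top sequentially"
  shows "XX_tendsto (\<lambda>n. D (r n)) E"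
  using assms(1) filterlim_compose[OF _ assms(2)]
  unfolding XX_tendsto_def by blast

text \<open>Three errors of size \<open>e/3\<close> add up: from \<open>p\<close> to
  \<open>q n\<close>, from \<open>q n\<close> to a point of \<open>closure E\<close>, and from there
  to a point of \<open>E\<close>.\<close>

lemma XX_tendsto_limit_mem_closure:
  assumes D: "XX_tendsto D E" and q: "q \<longlonglongrightarrow> p"
    and mem: "\<forall>\<^sub>F n in sequentially. q n \<in> D n"
  shows "p \<in> closure E"
  unfolding closure_approachable
proof (intro allI impI)
  fix e :: real assume e: "e > 0"
  obtain R0 where R0: "\<And>R e. R \<ge> R0 \<Longrightarrow> e > 0 \<Longrightarrow>
    \<forall>\<^sub>F n in sequentially.
      hausdorff_distance (closure (D n) \<inter> cball 0 R) (closure E \<inter> cball 0 R) < ennreal e"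
    using XX_tendstoD[OF D] by blast
  \<comment> \<open>The margin 1 keeps \<open>q n\<close> inside the ball of radius \<open>R\<close>
    once it is within distance 1 of \<open>p\<close>; hence the \<open>min 1\<close> below.\<close>
  define R where "R = max R0 (norm p + 1)"
  have "\<forall>\<^sub>F n in sequentially.
      hausdorff_distance (closure (D n) \<inter> cball 0 R) (closure E \<inter> cball 0 R) < ennreal (e/3)"
    by (rule R0) (use e in \<open>auto simp: R_def\<close>)
  moreover have "\<forall>\<^sub>F n in sequentially. dist (q n) p < min 1 (e/3)"
    by (rule tendstoD[OF q]) (use e in auto)
  ultimately have "\<forall>\<^sub>F n in sequentially. \<exists>y\<in>E. dist y p < e"
    using mem
  proof eventually_elim
    case (elim n)
    have "norm (q n) \<le> norm p + dist (q n) p"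
      by (metis dist_norm norm_triangle_sub)
    then have "q n \<in> closure (D n) \<inter> cball 0 R"
      using elim closure_subset[of "D n"] by (auto simp: R_def)
    then obtain y where y: "y \<in> closure E" "dist (q n) y < e/3"
      using hausdorff_distance_lessD(1)[OF elim(1)] by blast
    obtain y' where y': "y' \<in> E" "dist y' y < e/3"
      using y(1) e by (metis closure_approachable zero_less_divide_iff zero_less_numeral)
    have "dist y' p \<le> dist y' y + dist (q n) y + dist (q n) p"
      by metric
    then show ?case
      using y y' elim by (intro bexI[of _ y']) auto
  qed
  \<comment> \<open>The claim does not depend on \<open>n\<close>, so holding for almost all
    \<open>n\<close> means holding.\<close>
  then show "\<exists>y\<in>E. dist y p < e"
    by (simp add: eventually_const)
qed

text \<open>If some \<open>q\<close> in the ball were not in \<open>C\<close>, pushing it a distance \<open>e\<close> away from a separating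
  hyperplane would give a point of the larger ball too far from \<open>C\<close>.\<close>
lemma ball_subset_convex_if_approximated:
  fixes C :: "'a::euclidean_space set"
  assumes "convex C" "closed C" "e > 0"
    and approx: "\<And>x. x \<in> cball p (2 * e) \<Longrightarrow> \<exists>y\<in>C. dist x y < e"
  shows "ball p e \<subseteq> C"
proof
  fix q assume q: "q \<in> ball p e"
  show "q \<in> C"
  proof (rule ccontr)
    assume "q \<notin> C"
    then obtain a b where a: "inner a q < b" and b: "\<And>x. x \<in> C \<Longrightarrow> b < inner a x"
      using separating_hyperplane_closed_point assms(1,2) by metis
    have "C \<noteq> {}"
      using approx[of p] \<open>e > 0\<close> by auto
    then have "a \<noteq> 0"
      using a b by force
    define q' where "q' = q - (e / norm a) *\<^sub>R a"
    have "dist q q' = e"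
      using \<open>a \<noteq> 0\<close> \<open>e > 0\<close> by (simp add: q'_def dist_norm)
    then have "q' \<in> cball p (2 * e)"
      using q dist_triangle[of p q' q] by auto
    then obtain y where y: "y \<in> C" "dist q' y < e"
      using approx by blast
    have "inner a q' = inner a q - e * norm a"
      using \<open>a \<noteq> 0\<close> by (simp add: q'_def inner_diff_right dot_square_norm power2_eq_square)
    then have "e * norm a < inner a (y - q')"
      using a b[OF y(1)] by (simp add: inner_diff_right)
    also have "\<dots> \<le> norm a * norm (y - q')"
      by (rule norm_cauchy_schwarz)
    also have "\<dots> \<le> norm a * e"
      using y(2) by (intro mult_left_mono) (auto simp: dist_norm norm_minus_commute)
    finally show False
      by (simp add: mult.commute)
  qed
qed

text \<open>Hausdorff closeness alone would allow small holes in \<open>D n\<close> near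
  \<open>p\<close>; convexity excludes them.\<close>

lemma XX_tendsto_eventually_ball_subset:
  assumes D: "XX_tendsto D E" and conv: "\<And>n. convex (D n)" and E: "open E" "p \<in> E"
  obtains e where "e > 0" "\<forall>\<^sub>F n in sequentially. ball p e \<subseteq> D n"
proof -
  obtain R0 where R0: "\<And>R e. R \<ge> R0 \<Longrightarrow> e > 0 \<Longrightarrow>
    \<forall>\<^sub>F n in sequentially.
      hausdorff_distance (closure (D n) \<inter> cball 0 R) (closure E \<inter> cball 0 R) < ennreal e"
    using XX_tendstoD[OF D] by blast
  obtain d where d: "d > 0" "cball p d \<subseteq> E"
    using E open_contains_cball by blast
  \<comment> \<open>Halved because filling \<open>ball p e\<close> takes approximation of all points
    up to distance \<open>2 * e\<close> from \<open>p\<close>, and these must lie in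
    \<open>E\<close>.\<close>
  define e where "e = d / 2"
  have e: "e > 0" "cball p (2 * e) \<subseteq> E"
    using d by (auto simp: e_def)
  define R where "R = max R0 (norm p + 2 * e)"
  have "\<forall>\<^sub>F n in sequentially.
      hausdorff_distance (closure (D n) \<inter> cball 0 R) (closure E \<inter> cball 0 R) < ennreal e"
    by (rule R0) (use e in \<open>auto simp: R_def\<close>)
  then have "\<forall>\<^sub>F n in sequentially. ball p e \<subseteq> D n"
  proof eventually_elim
    case (elim n)
    have "ball p e \<subseteq> closure (D n)"
    proof (rule ball_subset_convex_if_approximated)
      fix x assume x: "x \<in> cball p (2 * e)"
      have "norm x \<le> norm p + dist p x"
        by (metis dist_commute dist_norm norm_triangle_sub)
      then have "x \<in> closure E \<inter> cball 0 R"
        using x e(2) closure_subset[of E] by (auto simp: R_def)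
      then show "\<exists>y\<in>closure (D n). dist x y < e"
        using hausdorff_distance_lessD(2)[OF elim] by (metis IntE dist_commute)
    qed (use conv e in auto)
    \<comment> \<open>A convex set and its closure have the same interior, so an open ball in the
      closure lies in \<open>D n\<close> itself.\<close>
    then have "ball p e \<subseteq> interior (closure (D n))"
      by (simp add: interior_maximal)
    then show ?case
      using convex_interior_closure[OF conv, of n] interior_subset[of "D n"] by auto
  qed
  with e(1) show thesis
    by (rule that)
qed

text \<open>Each \<open>p\<close> in \<open>D'\<close> eventually lies in \<open>D n\<close>, so
  \<open>f p\<close> is a limit of points of \<open>E n\<close> and belongs to
  \<open>closure E'\<close>. Since the image is open, it lies in the interior of that closure, which
  is \<open>E'\<close> by convexity and openness.\<close>

lemma XX_tendsto_image_subset: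
  assumes D: "XX_tendsto D D'" and E: "XX_tendsto E E'"
    and conv: "\<And>n. convex (D n)" "convex E'" and op: "open D'" "open E'" "open (f ` D')"
    and sub: "\<And>n. F n ` D n \<subseteq> E n" and lim: "\<And>p. (\<lambda>n. F n p) \<longlonglongrightarrow> f p"
  shows "f ` D' \<subseteq> E'"
proof -
  have "f p \<in> closure E'" if "p \<in> D'" for p
  proof (rule XX_tendsto_limit_mem_closure[OF E lim])
    obtain e where "e > 0" "\<forall>\<^sub>F n in sequentially. ball p e \<subseteq> D n"
      using XX_tendsto_eventually_ball_subset[OF D conv(1) op(1) \<open>p \<in> D'\<close>] by blast
    then have "\<forall>\<^sub>F n in sequentially. p \<in> D n"
      by (auto elim!: eventually_mono)
    then show "\<forall>\<^sub>F n in sequentially. F n p \<in> E n"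
      by (rule eventually_mono) (use sub in blast)
  qed
  then have "f ` D' \<subseteq> interior (closure E')"
    using op(3) by (intro interior_maximal) auto
  then show ?thesis
    using convex_interior_closure[OF conv(2)] interior_open[OF op(2)] by simp
qed

section \<open>Boundedness of the linear parts\<close>

text \<open>A complex line through the interior point \<open>u\<close> that stays in the closure
  would, contracted towards \<open>u\<close>, lie in \<open>E\<close> itself.\<close>

lemma properly_convex_line_not_in_closure:
  assumes "properly_convex E" "open E" "u \<in> E" "w \<noteq> 0"
  obtains \<zeta> where "u + \<zeta> *s w \<notin> closure E"
proof -
  have conv: "convex E"
    using assms(1) by (simp add: properly_convex_def)
  have "\<exists>\<zeta>. u + \<zeta> *s w \<notin> closure E"
  proof (rule ccontr)
    assume "\<not> ?thesis"
    then have line: "u + \<zeta> *s w \<in> closure E" for \<zeta>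
      by blast
    have "u + \<zeta> *s w \<in> E" for \<zeta>
    proof -
      \<comment> \<open>With the parameter doubled, \<open>u + \<zeta> *s w\<close> is the midpoint
        of the interior point \<open>u\<close> and a point of the closure, hence interior.\<close>
      have "(u + (2 * \<zeta>) *s w) - (1/2) *\<^sub>R ((u + (2 * \<zeta>) *s w) - u) \<in> interior E"
        by (rule mem_interior_closure_convex_shrink[OF conv])
           (use assms line in \<open>auto simp: interior_open\<close>)
      moreover have "(u + (2 * \<zeta>) *s w) - (1/2) *\<^sub>R ((u + (2 * \<zeta>) *s w) - u) = u + \<zeta> *s w"
        by (simp add: vec_eq_iff scaleR_conv_of_real[where 'a = complex])
      ultimately show ?thesis
        using interior_subset [of E] by (metis subsetD)
    qed
    then have "range (\<lambda>\<zeta>. u + \<zeta> *s w) \<subseteq> E"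
      by blast
    then show False
      using assms by (auto simp: properly_convex_def)
  qed
  then show thesis
    using that by blast
qed

text \<open>Stated for one direction, so that it serves for the transition maps and, with the roles
  exchanged, for their inverses. The convergent base points \<open>x n\<close> and their images
  control the translations \<open>c n\<close>.\<close>

lemma eventually_linear_parts_bounded:
  fixes D :: "nat \<Rightarrow> (complex ^ 'd) set" and M :: "nat \<Rightarrow> complex ^ 'd ^ 'd"
  assumes D: "XX_tendsto D D'" and E: "XX_tendsto E E'"
    and conv: "\<And>n. convex (D n)" and D': "open D'" "u \<in> D'"
    and E': "properly_convex E'" "open E'" "v \<in> E'"
    and sub: "\<And>n. (\<lambda>z. M n *v z + c n) ` D n \<subseteq> E n"
    and x: "x \<longlonglongrightarrow> u" and y: "(\<lambda>n. M n *v x n + c n) \<longlonglongrightarrow> v"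
  obtains K where "\<forall>\<^sub>F n in sequentially. \<forall>h. norm (M n *v h) \<le> K * norm h"
proof -
  obtain e where e: "e > 0" "\<forall>\<^sub>F n in sequentially. ball u e \<subseteq> D n"
    using XX_tendsto_eventually_ball_subset[OF D conv D'] by blast
  have "\<exists>K. \<forall>\<^sub>F n in sequentially. \<forall>h. norm (M n *v h) \<le> K * norm h"
  proof (rule ccontr)
    assume "\<not> ?thesis"
    \<comment> \<open>Each candidate bound \<open>K = k\<close> fails at some index beyond
      \<open>k\<close>. The chosen indices \<open>s k\<close> tend to infinity but need not
      increase.\<close>
    then have "\<exists>n\<ge>k. \<exists>h. norm (M n *v h) > real k * norm h" for k
      by (force simp: eventually_sequentially not_le)
    then obtain s h where s: "\<And>k. s k \<ge> k"
      and h: "\<And>k. norm (M (s k) *v h k) > real k * norm (h k)"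
      by metis
    have pos: "norm (M (s k) *v h k) > 0" for k
      using h[of k] by (meson le_less_trans mult_nonneg_nonneg norm_ge_zero of_nat_0_le_iff)
    define w where "w k = (1 / norm (M (s k) *v h k)) *\<^sub>R (M (s k) *v h k)" for k
    have w: "norm (w k) = 1" for k
      using pos[of k] by (auto simp: w_def)
    then have "bounded (range w)"
      by (auto simp: bounded_iff)
    then obtain l t where t: "strict_mono t" "(w \<circ> t) \<longlonglongrightarrow> l"
      using bounded_imp_convergent_subsequence by blast
    have "norm l = 1"
      using tendsto_norm[OF t(2)] by (simp add: w LIMSEQ_const_iff)
    then have "l \<noteq> 0"
      by auto
    then obtain \<zeta> where \<zeta>: "v + \<zeta> *s l \<notin> closure E'"
      using properly_convex_line_not_in_closure[OF E'] by blast
    define r where "r k = s (t k)" for k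
    have r_ge: "r k \<ge> k" for k
      unfolding r_def using s seq_suble[OF t(1)] le_trans by blast
    have r: "filterlim r at_top sequentially"
      by (rule filterlim_at_top_mono[OF filterlim_ident]) (simp add: r_ge)
    \<comment> \<open>Scaled so that \<open>M (r k)\<close> sends \<open>g k\<close> to
      \<open>\<zeta>\<close> times the unit vector \<open>w (t k)\<close>. The stretching factor
      exceeds \<open>k\<close>, so \<open>g k\<close> tends to 0: an ever smaller move in the domain
      shifts the image by a fixed length along \<open>w (t k)\<close>.\<close>
    define g where "g k = (\<zeta> / norm (M (r k) *v h (t k))) *s h (t k)" for k
    have Mg: "M (r k) *v g k = \<zeta> *s w (t k)" for k
      by (simp add: g_def w_def r_def vec_eq_iff vec.scale scaleR_conv_of_real[where 'a = complex])
    have norm_g: "real k * norm (g k) \<le> norm \<zeta>" for k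
    proof -
      have "real k * norm (h (t k)) \<le> real (t k) * norm (h (t k))"
        using seq_suble[OF t(1), of k] by (intro mult_right_mono) auto
      also have "\<dots> \<le> norm (M (r k) *v h (t k))"
        using h[of "t k"] by (simp add: r_def)
      finally have "norm \<zeta> * (real k * norm (h (t k))) \<le> norm \<zeta> * norm (M (r k) *v h (t k))"
        by (rule mult_left_mono) simp
      then show ?thesis
        using pos[of "t k"]
        by (simp add: g_def norm_vector_scalar_mult norm_divide r_def field_simps)
    qed
    have "g \<longlonglongrightarrow> 0"
    proof (rule tendsto_norm_zero_cancel, rule tendsto_sandwich[of "\<lambda>_. 0"])
      \<comment> \<open>At \<open>k = 0\<close> the right-hand side is 0 by the convention for
        division, so the bound is claimed only eventually.\<close>
      show "\<forall>\<^sub>F k in sequentially. norm (g k) \<le> norm \<zeta> / real k"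
        using eventually_gt_at_top[of 0]
        by eventually_elim (use norm_g in \<open>simp add: field_simps\<close>)
      show "(\<lambda>k. norm \<zeta> / real k) \<longlonglongrightarrow> 0"
        by (rule lim_const_over_n)
    qed auto
    then have "(\<lambda>k. x (r k) + g k) \<longlonglongrightarrow> u"
      using tendsto_add[OF filterlim_compose[OF x r]] by fastforce
    then have "\<forall>\<^sub>F k in sequentially. dist (x (r k) + g k) u < e"
      using e(1) by (rule tendstoD)
    moreover have "\<forall>\<^sub>F k in sequentially. ball u e \<subseteq> D (r k)"
      using e(2) r by (rule eventually_compose_filterlim)
    ultimately have "\<forall>\<^sub>F k in sequentially. M (r k) *v x (r k) + c (r k) + \<zeta> *s w (t k) \<in> E (r k)"
    proof eventually_elim
      case (elim k)
      then have "x (r k) + g k \<in> D (r k)"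
        by (auto simp: dist_commute)
      then have "M (r k) *v (x (r k) + g k) + c (r k) \<in> E (r k)"
        using sub by blast
      then show ?case
        by (simp add: matrix_vector_right_distrib Mg algebra_simps)
    qed
    moreover have "(\<lambda>k. M (r k) *v x (r k) + c (r k) + \<zeta> *s w (t k)) \<longlonglongrightarrow> v + \<zeta> *s l"
    proof (rule tendsto_add)
      show "(\<lambda>k. M (r k) *v x (r k) + c (r k)) \<longlonglongrightarrow> v"
        using filterlim_compose[OF y r] .
      show "(\<lambda>k. \<zeta> *s w (t k)) \<longlonglongrightarrow> \<zeta> *s l"
        unfolding vector_scalar_mult_def
        using t(2) by (intro vec_tendstoI) (auto intro!: tendsto_intros simp: o_def)
    qed
    ultimately have "v + \<zeta> *s l \<in> closure E'"
      using XX_tendsto_limit_mem_closure[OF XX_tendsto_compose[OF E r]] by blast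
    with \<zeta> show False ..
  qed
  then show thesis
    using that by blast
qed

section \<open>Convergence of the transition maps\<close>

theorem proposition3p7:
  fixes \<Omega> :: "nat \<Rightarrow> (complex ^ 'd) set"
    and z :: "nat \<Rightarrow> complex ^ 'd"
    and A B :: "nat \<Rightarrow> (complex ^ 'd) \<Rightarrow> (complex ^ 'd)"
    and U1 U2 :: "(complex ^ 'd) set"
    and u1 u2 :: "complex ^ 'd"
  assumes "\<And>n. (\<Omega> n, z n) \<in> XX0"
    and "\<And>n. A n \<in> Aff"
    and "\<And>n. B n \<in> Aff"
    and "(U1, u1) \<in> XX0"
    and "(U2, u2) \<in> XX0"
    and "XX0_tendsto (\<lambda>n. aff_act (A n) (\<Omega> n, z n)) (U1, u1)"
    and "XX0_tendsto (\<lambda>n. aff_act (B n) (\<Omega> n, z n)) (U2, u2)"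
  shows "\<exists>r :: nat \<Rightarrow> nat. filterlim r at_top sequentially \<and>
           (\<exists>T \<in> Aff. Aff_tendsto (\<lambda>j. B (r j) \<circ> inv (A (r j))) T \<and>
              aff_act T (U1, u1) = (U2, u2))"
proof -
  define V W where "V n = A n ` \<Omega> n" and "W n = B n ` \<Omega> n" for n
  define x y where "x n = A n (z n)" and "y n = B n (z n)" for n
  have V: "XX_tendsto V U1" and x: "x \<longlonglongrightarrow> u1"
    using assms(6) by (simp_all add: XX0_tendsto_def aff_act_def V_def[abs_def] x_def[abs_def])
  have W: "XX_tendsto W U2" and y: "y \<longlonglongrightarrow> u2"
    using assms(7) by (simp_all add: XX0_tendsto_def aff_act_def W_def[abs_def] y_def[abs_def])
  have U1: "properly_convex U1" "open U1" "u1 \<in> U1" "convex U1"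
    and U2: "properly_convex U2" "open U2" "u2 \<in> U2" "convex U2"
    using assms(4,5) by (auto simp: XX0_def XX_def properly_convex_def)
  have "convex (\<Omega> n)" for n
    using assms(1)[of n] by (auto simp: XX0_def XX_def properly_convex_def)
  then have convV: "convex (V n)" and convW: "convex (W n)" for n
    using assms(2,3) by (auto simp: V_def W_def intro: convex_Aff_image)

  have "\<exists>M c. B n \<circ> inv (A n) = (\<lambda>p. M *v p + c)" for n
    using assms(2,3) by (rule Aff_transition)
  then obtain M c where F: "\<And>n. B n \<circ> inv (A n) = (\<lambda>p. M n *v p + c n)"
    by metis
  have "\<exists>N d. A n \<circ> inv (B n) = (\<lambda>p. N *v p + d)" for n
    using assms(3,2) by (rule Aff_transition)
  then obtain N d where G: "\<And>n. A n \<circ> inv (B n) = (\<lambda>p. N n *v p + d n)"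
    by metis
  have bij: "bij (A n)" "bij (B n)" for n
    using assms(2,3) by (simp_all add: Aff_inverse(1))
  have FA: "M n *v A n p + c n = B n p" for n p
    using fun_cong[OF F, of n "A n p"] bij(1)[of n] by (simp add: bij_is_inj)
  have GB: "N n *v B n p + d n = A n p" for n p
    using fun_cong[OF G, of n "B n p"] bij(2)[of n] by (simp add: bij_is_inj)
  \<comment> \<open>Evaluating \<open>FA\<close> at \<open>inv (B n) p\<close> shows that the two
    transition maps compose to the identity.\<close>
  have FG: "M n *v (N n *v p + d n) + c n = p" for n p
    using FA[of n "inv (B n) p"] fun_cong[OF G, of n p] bij(2)[of n]
    by (simp add: bij_is_surj surj_f_inv_f)
  have MN: "M n ** N n = mat 1" for n
    using FG by (rule affine_inverse_matrix)
  have VW: "(\<lambda>p. M n *v p + c n) ` V n \<subseteq> W n" and WV: "(\<lambda>p. N n *v p + d n) ` W n \<subseteq> V n" for n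
    by (auto simp: V_def W_def FA GB)
  have Fx: "M n *v x n + c n = y n" and Gy: "N n *v y n + d n = x n" for n
    by (simp_all add: x_def y_def FA GB)

  obtain K where K: "\<forall>\<^sub>F n in sequentially. \<forall>h. norm (M n *v h) \<le> K * norm h"
    by (rule eventually_linear_parts_bounded[OF V W convV U1(2,3) U2(1-3) VW x])
       (use y in \<open>simp_all add: Fx\<close>)
  obtain K' where K': "\<forall>\<^sub>F n in sequentially. \<forall>h. norm (N n *v h) \<le> K' * norm h"
    by (rule eventually_linear_parts_bounded[OF W V convW U2(2,3) U1(1-3) WV y])
       (use x in \<open>simp_all add: Gy\<close>)
  obtain n0 where n0: "\<And>n. n \<ge> n0 \<Longrightarrow>
      (\<forall>h. norm (M n *v h) \<le> K * norm h) \<and> (\<forall>h. norm (N n *v h) \<le> K' * norm h)"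
    using eventually_conj[OF K K'] by (auto simp: eventually_sequentially)
  \<comment> \<open>The shift by \<open>n0\<close> makes both bounds hold at every index, as
    boundedness of the whole range requires. Pairing the matrices gives one subsequence along which
    both converge.\<close>
  define P where "P n = (M (n + n0), N (n + n0))" for n
  have "bounded (range P)"
  proof -
    have "bounded (range (\<lambda>n. M (n + n0)))" "bounded (range (\<lambda>n. N (n + n0)))"
      by (rule bounded_range_matrices, use n0 le_add2 in blast)+
    then have "bounded (range (\<lambda>n. M (n + n0)) \<times> range (\<lambda>n. N (n + n0)))"
      by (rule bounded_Times)
    then show ?thesis
      by (rule bounded_subset) (auto simp: P_def)
  qed
  then obtain l s where s: "strict_mono s" "(P \<circ> s) \<longlonglongrightarrow> l"
    using bounded_imp_convergent_subsequence by blast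
  define r where "r j = s j + n0" for j
  have r: "filterlim r at_top sequentially"
    unfolding r_def
    by (intro filterlim_subseq[OF strict_monoI]) (use s(1) in \<open>simp add: strict_mono_less\<close>)
  define L L' where "L = fst l" and "L' = snd l"
  have L: "(\<lambda>j. M (r j)) \<longlonglongrightarrow> L" and L': "(\<lambda>j. N (r j)) \<longlonglongrightarrow> L'"
    using tendsto_fst[OF s(2)] tendsto_snd[OF s(2)]
    by (simp_all add: P_def r_def L_def L'_def o_def)
  \<comment> \<open>The identity \<open>M n ** N n = mat 1\<close> survives in the limit, so
    \<open>L\<close> cannot degenerate; this is why the inverses had to be bounded too.\<close>
  have LL': "L ** L' = mat 1"
    using tendsto_matrix_matrix_mult[OF L L'] by (simp add: MN LIMSEQ_const_iff)
  then have L'L: "L' ** L = mat 1"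
    by (simp add: matrix_left_right_inverse)
  \<comment> \<open>The translation is forced by \<open>T u1 = u2\<close>, and likewise that of
    \<open>S\<close> by \<open>S u2 = u1\<close>.\<close>
  define T where "T p = L *v p + (u2 - L *v u1)" for p
  define S where "S p = L' *v p + (u1 - L' *v u2)" for p
  have xr: "(\<lambda>j. x (r j)) \<longlonglongrightarrow> u1" and yr: "(\<lambda>j. y (r j)) \<longlonglongrightarrow> u2"
    using filterlim_compose[OF x r] filterlim_compose[OF y r] by auto
  \<comment> \<open>The translations are determined by the linear parts and the convergent base
    points, so they converge without a further subsequence.\<close>
  have c_eq: "c n = y n - M n *v x n" and d_eq: "d n = x n - N n *v y n" for n
    using Fx[of n] Gy[of n] by (simp_all add: eq_diff_eq add.commute)
  have c: "(\<lambda>j. c (r j)) \<longlonglongrightarrow> u2 - L *v u1"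
    unfolding c_eq by (intro tendsto_diff tendsto_matrix_vector_mult L xr yr)
  have d: "(\<lambda>j. d (r j)) \<longlonglongrightarrow> u1 - L' *v u2"
    unfolding d_eq by (intro tendsto_diff tendsto_matrix_vector_mult L' xr yr)
  have Tlim: "(\<lambda>j. M (r j) *v p + c (r j)) \<longlonglongrightarrow> T p" for p
    unfolding T_def by (intro tendsto_add tendsto_matrix_vector_mult L c tendsto_const)
  have Slim: "(\<lambda>j. N (r j) *v p + d (r j)) \<longlonglongrightarrow> S p" for p
    unfolding S_def by (intro tendsto_add tendsto_matrix_vector_mult L' d tendsto_const)
  have TS: "T (S p) = p" and ST: "S (T p) = p" for p
    by (simp_all add: T_def S_def matrix_vector_right_distrib matrix_vector_mult_diff_distrib
        matrix_vector_mul_assoc LL' L'L)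
  have cont: "continuous_on UNIV T" "continuous_on UNIV S"
    unfolding T_def S_def
    by (intro continuous_on_add continuous_on_const linear_continuous_on
        matrix_vector_mul_bounded_linear)+
  \<comment> \<open>Writing each image as a preimage under the continuous inverse shows that it is
    open.\<close>
  have "T ` U1 = S -` U1"
    by (auto simp: ST) (metis TS image_eqI)
  moreover have "S ` U2 = T -` U2"
    by (auto simp: TS) (metis ST image_eqI)
  ultimately have "open (T ` U1)" "open (S ` U2)"
    using cont U1(2) U2(2) by (simp_all add: open_vimage)
  then have TU: "T ` U1 \<subseteq> U2" and SU: "S ` U2 \<subseteq> U1"
    using XX_tendsto_image_subset[OF XX_tendsto_compose[OF V r] XX_tendsto_compose[OF W r]
        convV U2(4) U1(2) U2(2) _ VW Tlim]
      XX_tendsto_image_subset[OF XX_tendsto_compose[OF W r] XX_tendsto_compose[OF V r]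
        convW U1(4) U2(2) U1(2) _ WV Slim]
    by auto
  have "U2 \<subseteq> T ` U1"
  proof
    fix p assume "p \<in> U2"
    then have "S p \<in> U1"
      using SU by blast
    then have "T (S p) \<in> T ` U1"
      by (rule imageI)
    then show "p \<in> T ` U1"
      by (simp only: TS)
  qed
  with TU have "T ` U1 = U2"
    by (rule subset_antisym)
  then have "aff_act T (U1, u1) = (U2, u2)"
    by (simp add: aff_act_def T_def)
  moreover have "T \<in> Aff"
    unfolding Aff_def T_def using LL' L'L invertible_def by blast
  moreover have "Aff_tendsto (\<lambda>j. B (r j) \<circ> inv (A (r j))) T"
    unfolding Aff_tendsto_def F T_def[abs_def] aff_linear_part_eq using L c by simp
  ultimately show ?thesis
    using r by blast
qed

end
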